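(* Let $\mathbf P=\{(\alpha_j,p_j)\}_{j=1}^n$ ($n\ge3$) be a cooriented polygon with turning angles $\theta_{j+\frac12}$, and let $\{(\alpha_j^*,p_j^* )\}_{j=1}^n$ be its $\mathcal P$-evolute. Then $\alpha_j^*=\alpha_j+\pi/2$, and the vectors $p=(p_1,\dots,p_n)$ and $p^*=(p_1^*,\dots,p_n^* )$ are related by $p^*=\mathcal P_\theta p$, where $\mathcal P_\theta$ is the cyclically tridiagonal matrix defined by $$(\mathcal P_\theta p)_j=\tfrac12\bigl(-b_j\,p_{j-1}+(a_j-a_{j+1})\,p_j+b_{j+1}\,p_{j+1}\bigr),\qquad a_j=\cot\theta_{j-\frac12},\quad b_j=\csc\theta_{j-\frac12},$$ with all indices taken modulo $n$.
   Context: A cooriented line $(\alpha,p)$, $\alpha\in\mathbb R/2\pi\mathbb Z$, $p\in\mathbb R$, is the line $x\cos\alpha+y\sin\alpha=p$ with coorienting normal $(\cos\alpha,\sin\alpha)$; it is oriented by the normal turned counterclockwise by $\pi/2$. A cooriented $n$-gon is a cyclically ordered sequence of cooriented lines $l_j=(\alpha_j,p_j)$ (indices mod $n$) such that $l_j$ and $l_{j+1}$ meet at a single point $P_{j+\frac12}$, the $j$-th vertex. The turning angle is $\theta_{j+\frac12}\equiv\alpha_{j+1}-\alpha_j \pmod{2\pi}$. The perpendicular bisector evolute ($\mathcal P$-evolute) of the polygon is the cooriented polygon $(l_1^*,\dots,l_n^* )$, where $l_j^*$ passes through the midpoint of the segment $P_{j-\frac12}P_{j+\frac12}$ and its direction is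 obtained from the direction of the oriented line $l_j$ by a counterclockwise quarter-turn. *)

theory Defs
  imports "HOL-Analysis.Line_Segment" "Jordan_Normal_Form.Matrix"
begin

definition angle_rel :: "real \<Rightarrow> real \<Rightarrow> bool" where
  "angle_rel x y \<longleftrightarrow> (\<exists>k::int. x - y = 2 * pi * of_int k)"

lemma equivp_angle_rel: "equivp angle_rel"
proof (rule equivpI)
  show "reflp angle_rel"
    by (rule reflpI) (auto simp: angle_rel_def intro: exI[of _ 0])
  show "symp angle_rel"
  proof (rule sympI)
    fix x y assume "angle_rel x y"
    then obtain k :: int where "x - y = 2 * pi * of_int k"
      by (auto simp: angle_rel_def)
    then have "y - x = 2 * pi * of_int (- k)"
      by simp
    then show "angle_rel y x"
      unfolding angle_rel_def by blast
  qed
  show "transp angle_rel"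
  proof (rule transpI)
    fix x y z assume "angle_rel x y" "angle_rel y z"
    then obtain k m :: int where "x - y = 2 * pi * of_int k" "y - z = 2 * pi * of_int m"
      by (auto simp: angle_rel_def)
    then have "x - z = 2 * pi * of_int (k + m)"
      by (simp add: algebra_simps)
    then show "angle_rel x z"
      unfolding angle_rel_def by blast
  qed
qed

quotient_type angle = real / angle_rel
  by (rule equivp_angle_rel)

lift_definition angle_of :: "real \<Rightarrow> angle" is "\<lambda>x. x" .

instantiation angle :: ab_group_add
begin

lift_definition zero_angle :: angle is 0 .

lift_definition plus_angle :: "angle \<Rightarrow> angle \<Rightarrow> angle" is "(+)"
proof -
  fix x x' y y' assume "angle_rel x x'" "angle_rel y y'"
  then obtain k m :: int where "x - x' = 2 * pi * of_int k" "y - y' = 2 * pi * of_int m"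
    by (auto simp: angle_rel_def)
  then have "(x + y) - (x' + y') = 2 * pi * of_int (k + m)"
    by (simp add: algebra_simps)
  then show "angle_rel (x + y) (x' + y')"
    unfolding angle_rel_def by blast
qed

lift_definition uminus_angle :: "angle \<Rightarrow> angle" is uminus
proof -
  fix x x' assume "angle_rel x x'"
  then obtain k :: int where "x - x' = 2 * pi * of_int k"
    by (auto simp: angle_rel_def)
  then have "(- x) - (- x') = 2 * pi * of_int (- k)"
    by simp
  then show "angle_rel (- x) (- x')"
    unfolding angle_rel_def by blast
qed

definition minus_angle :: "angle \<Rightarrow> angle \<Rightarrow> angle" where
  "minus_angle x y = x + (- y)"

instance
proof
  fix x y z :: angle
  show "x + y + z = x + (y + z)"
    by transfer (simp add: add.assoc equivp_reflp[OF equivp_angle_rel])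
  show "x + y = y + x"
    by transfer (simp add: add.commute equivp_reflp[OF equivp_angle_rel])
  show "0 + x = x"
    by transfer (simp add: equivp_reflp[OF equivp_angle_rel])
  show "- x + x = 0"
    by transfer (simp add: equivp_reflp[OF equivp_angle_rel])
  show "x - y = x + (- y)"
    by (rule minus_angle_def)
qed

end

lemma angle_rel_cos_sin:
  assumes "angle_rel x y"
  shows "cos x = cos y" and "sin x = sin y"
proof -
  obtain k :: int where "x - y = 2 * pi * of_int k"
    using assms by (auto simp: angle_rel_def)
  then have "sin x = sin y \<and> cos x = cos y"
    by (subst sin_cos_eq_iff) (auto simp: algebra_simps)
  then show "cos x = cos y" and "sin x = sin y"
    by auto
qed

lift_definition angle_cos :: "angle \<Rightarrow> real" is cos
  by (rule angle_rel_cos_sin)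

lift_definition angle_sin :: "angle \<Rightarrow> real" is sin
  by (rule angle_rel_cos_sin)

definition angle_cot :: "angle \<Rightarrow> real" where
  "angle_cot x = angle_cos x / angle_sin x"

definition angle_csc :: "angle \<Rightarrow> real" where
  "angle_csc x = 1 / angle_sin x"

text \<open>A cooriented line is the pair \<open>(\<alpha>, p)\<close>; the plane is \<open>real \<times> real\<close>.\<close>

type_synonym coor_line = "angle \<times> real"

definition points_of :: "coor_line \<Rightarrow> (real \<times> real) set" where
  "points_of l = {(x, y). x * angle_cos (fst l) + y * angle_sin (fst l) = snd l}"

definition normal :: "coor_line \<Rightarrow> real \<times> real" where
  "normal l = (angle_cos (fst l), angle_sin (fst l))"

definition quarter_turn :: "real \<times> real \<Rightarrow> real \<times> real" where
  "quarter_turn v = (- snd v, fst v)"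

definition direction :: "coor_line \<Rightarrow> real \<times> real" where
  "direction l = quarter_turn (normal l)"

text \<open>A cyclic sequence of length \<open>n\<close> is an \<open>n\<close>-periodic sequence indexed by the integers.
  Objects with half-integer index \<open>j + 1/2\<close> are stored at index \<open>j\<close>.\<close>

definition cooriented_polygon :: "nat \<Rightarrow> (int \<Rightarrow> coor_line) \<Rightarrow> bool" where
  "cooriented_polygon n l \<longleftrightarrow>
     (\<forall>j. l (j + int n) = l j) \<and>
     (\<forall>j. \<exists>!P. P \<in> points_of (l j) \<inter> points_of (l (j + 1)))"

definition vertex :: "(int \<Rightarrow> coor_line) \<Rightarrow> int \<Rightarrow> real \<times> real" where
  "vertex l j = (THE P. P \<in> points_of (l j) \<inter> points_of (l (j + 1)))"

definition turning_angle :: "(int \<Rightarrow> coor_line) \<Rightarrow> int \<Rightarrow> angle" where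
  "turning_angle l j = fst (l (j + 1)) - fst (l j)"

definition P_evolute :: "(int \<Rightarrow> coor_line) \<Rightarrow> int \<Rightarrow> coor_line" where
  "P_evolute l j = (THE m.
     midpoint (vertex l (j - 1)) (vertex l j) \<in> points_of m \<and>
     direction m = quarter_turn (direction (l j)))"

text \<open>Here \<open>\<theta> j\<close> stands for the turning angle with index \<open>j + 1/2\<close>.\<close>

definition coeff_a :: "(int \<Rightarrow> angle) \<Rightarrow> int \<Rightarrow> real" where
  "coeff_a \<theta> j = angle_cot (\<theta> (j - 1))"

definition coeff_b :: "(int \<Rightarrow> angle) \<Rightarrow> int \<Rightarrow> real" where
  "coeff_b \<theta> j = angle_csc (\<theta> (j - 1))"

definition cyc_entry :: "real vec \<Rightarrow> int \<Rightarrow> real" where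
  "cyc_entry x j = x $ nat (j mod int (dim_vec x))"

definition P_action :: "(int \<Rightarrow> angle) \<Rightarrow> real vec \<Rightarrow> int \<Rightarrow> real" where
  "P_action \<theta> x j = 1/2 * (- coeff_b \<theta> j * cyc_entry x (j - 1)
     + (coeff_a \<theta> j - coeff_a \<theta> (j + 1)) * cyc_entry x j
     + coeff_b \<theta> (j + 1) * cyc_entry x (j + 1))"

text \<open>The \<open>k\<close>-th column is the image of the \<open>k\<close>-th standard basis vector.\<close>

definition P_matrix :: "nat \<Rightarrow> (int \<Rightarrow> angle) \<Rightarrow> real mat" where
  "P_matrix n \<theta> = mat n n (\<lambda>(j, k). P_action \<theta> (unit_vec n k) (int j))"

definition cyclically_tridiagonal :: "nat \<Rightarrow> real mat \<Rightarrow> bool" where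
  "cyclically_tridiagonal n M \<longleftrightarrow> M \<in> carrier_mat n n \<and>
     (\<forall>j<n. \<forall>k<n. M $$ (j, k) \<noteq> 0 \<longrightarrow>
        (\<exists>d\<in>{-1, 0, 1}. int k = (int j + d) mod int n))"

end

theory Submission
  imports Defs
begin

text \<open>In the orthonormal frame given by the normal and the direction of \<open>l\<^sub>j\<close>, each of the two vertices
  on \<open>l\<^sub>j\<close> has the direction coordinate obtained by solving a \<open>2 \<times> 2\<close> linear system with determinant
  \<open>sin \<theta>\<close>, namely \<open>b p\<^sub>j\<^sub>+\<^sub>1 - a p\<^sub>j\<close> and \<open>a p\<^sub>j - b p\<^sub>j\<^sub>-\<^sub>1\<close> (with \<open>a\<close>, \<open>b\<close> the cotangent and cosecant of
  the respective turning angle). The normal of \<open>l\<^sub>j\<^sup>*\<close> is the direction of \<open>l\<^sub>j\<close>, so \<open>p\<^sub>j\<^sup>*\<close> is the mean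
  of these two coordinates.\<close>

lemma angle_cos_add_pi_half: "angle_cos (x + angle_of (pi / 2)) = - angle_sin x"
  by transfer (simp add: cos_add)

lemma angle_sin_add_pi_half: "angle_sin (x + angle_of (pi / 2)) = angle_cos x"
  by transfer (simp add: sin_add)

lemma angle_cos_diff: "angle_cos (x - y) = angle_cos x * angle_cos y + angle_sin x * angle_sin y"
  unfolding diff_conv_add_uminus by transfer (simp add: cos_diff)

lemma angle_sin_diff: "angle_sin (x - y) = angle_sin x * angle_cos y - angle_cos x * angle_sin y"
  unfolding diff_conv_add_uminus by transfer (simp add: sin_diff)

lemma angle_sin_cos_squared: "angle_sin x * angle_sin x + angle_cos x * angle_cos x = 1"
  by transfer (metis power2_eq_square sin_cos_squared_add)

text \<open>This gives the uniqueness of the evolute line: equal direction vectors force equal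
  angles modulo \<open>2 * pi\<close>.\<close>

lemma angle_eqI:
  assumes "angle_cos x = angle_cos y" "angle_sin x = angle_sin y"
  shows "x = y"
  using assms
proof transfer
  fix x y :: real assume "cos x = cos y" "sin x = sin y"
  then obtain k :: int where "x = y + 2 * pi * k"
    using sin_cos_eq_iff[of x y] by auto
  then show "angle_rel x y"
    by (auto simp: angle_rel_def)
qed

text \<open>If the sine vanishes, the lines are parallel, and moving a common point along the
  direction of \<open>m\<close> yields a second common point, against uniqueness.\<close>

lemma angle_sin_diff_nonzero:
  assumes "\<exists>!P. P \<in> points_of m \<inter> points_of m'"
  shows "angle_sin (fst m' - fst m) \<noteq> 0"
proof
  assume s: "angle_sin (fst m' - fst m) = 0"
  obtain x y where P: "(x, y) \<in> points_of m \<inter> points_of m'"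
    using assms by auto
  let ?Q = "(x - angle_sin (fst m), y + angle_cos (fst m))"
  have "?Q \<in> points_of m \<inter> points_of m'"
    using P s by (auto simp: points_of_def angle_sin_diff algebra_simps)
  then have "?Q = (x, y)"
    using P assms by blast
  \<comment> \<open>No movement would mean that sine and cosine of \<open>fst m\<close> both
    vanish.\<close>
  then show False
    using angle_sin_cos_squared[of "fst m"] by simp
qed

lemma line_intersection_direction_coordinates:
  assumes "(x, y) \<in> points_of m \<inter> points_of m'"
    and s: "angle_sin (fst m' - fst m) \<noteq> 0"
  shows "- x * angle_sin (fst m) + y * angle_cos (fst m) =
      angle_csc (fst m' - fst m) * snd m' - angle_cot (fst m' - fst m) * snd m" (is ?fst)
    and "- x * angle_sin (fst m') + y * angle_cos (fst m') =
      angle_cot (fst m' - fst m) * snd m' - angle_csc (fst m' - fst m) * snd m" (is ?snd)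
proof -
  define c d c' d' where defs: "c = angle_cos (fst m)" "d = angle_sin (fst m)"
    "c' = angle_cos (fst m')" "d' = angle_sin (fst m')"
  have p: "snd m = x * c + y * d" "snd m' = x * c' + y * d'"
    using assms(1) by (auto simp: points_of_def defs)
  have u: "d * d + c * c = 1" "d' * d' + c' * c' = 1"
    using angle_sin_cos_squared by (auto simp: defs)
  have n: "d' * c - c' * d \<noteq> 0"
    using s by (simp add: defs angle_sin_diff)
  \<comment> \<open>The normal \<open>(c', d')\<close> is expanded in the frame
    \<open>(c, d)\<close>, \<open>(- d, c)\<close> and paired with \<open>(x, y)\<close>. The
    coefficients \<open>c' * c + d' * d\<close> and \<open>d' * c - c' * d\<close> are cosine and
    sine of the turning angle; the factor \<open>d * d + c * c\<close> makes this a polynomial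
    identity.\<close>
  have "(- x * d + y * c) * (d' * c - c' * d) =
      (x * c' + y * d') * (d * d + c * c) - (c' * c + d' * d) * (x * c + y * d)"
    by (simp add: algebra_simps)
  then have "(- x * d + y * c) * (d' * c - c' * d) =
      (x * c' + y * d') - (c' * c + d' * d) * (x * c + y * d)"
    by (simp only: u mult_1_right)
  then show ?fst
    using n unfolding angle_cot_def angle_csc_def angle_sin_diff angle_cos_diff defs[symmetric] p
    by (simp add: divide_simps)
  \<comment> \<open>Now \<open>(c, d)\<close> is expanded in the frame of the second line, where the
    sine enters with the opposite sign.\<close>
  have "(- x * d' + y * c') * (d' * c - c' * d) =
      (c' * c + d' * d) * (x * c' + y * d') - (x * c + y * d) * (d' * d' + c' * c')"
    by (simp add: algebra_simps)
  then have "(- x * d' + y * c') * (d' * c - c' * d) =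
      (c' * c + d' * d) * (x * c' + y * d') - (x * c + y * d)"
    by (simp only: u mult_1_right)
  then show ?snd
    using n unfolding angle_cot_def angle_csc_def angle_sin_diff angle_cos_diff defs[symmetric] p
    by (simp add: divide_simps)
qed

lemma vertex_in_lines:
  assumes "cooriented_polygon n l"
  shows "vertex l j \<in> points_of (l j) \<inter> points_of (l (j + 1))"
  unfolding vertex_def by (rule theI') (use assms in \<open>simp add: cooriented_polygon_def\<close>)

lemma turning_angle_sin_nonzero:
  assumes "cooriented_polygon n l"
  shows "angle_sin (fst (l (j + 1)) - fst (l j)) \<noteq> 0"
  by (rule angle_sin_diff_nonzero) (use assms in \<open>simp add: cooriented_polygon_def\<close>)

text \<open>This replaces the definite description by an explicit pair: the prescribed direction
  fixes the angle, and then the midpoint fixes the offset.\<close>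

lemma P_evolute_eq:
  "P_evolute l j = (fst (l j) + angle_of (pi / 2),
     - fst (midpoint (vertex l (j - 1)) (vertex l j)) * angle_sin (fst (l j))
     + snd (midpoint (vertex l (j - 1)) (vertex l j)) * angle_cos (fst (l j)))"
  (is "_ = ?m")
  unfolding P_evolute_def
proof (rule the_equality)
  show "midpoint (vertex l (j - 1)) (vertex l j) \<in> points_of ?m \<and>
      direction ?m = quarter_turn (direction (l j))"
    by (auto simp: points_of_def direction_def normal_def quarter_turn_def
        angle_cos_add_pi_half angle_sin_add_pi_half split: prod.splits)
next
  fix m assume m: "midpoint (vertex l (j - 1)) (vertex l j) \<in> points_of m \<and>
      direction m = quarter_turn (direction (l j))"
  then have "fst m = fst (l j) + angle_of (pi / 2)"
    by (intro angle_eqI)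
      (auto simp: direction_def normal_def quarter_turn_def
        angle_cos_add_pi_half angle_sin_add_pi_half)
  with m show "m = ?m"
    by (cases m) (auto simp: points_of_def angle_cos_add_pi_half angle_sin_add_pi_half
        split: prod.splits)
qed

lemma snd_P_evolute:
  assumes "cooriented_polygon n l"
  shows "snd (P_evolute l j) = 1/2 * (- coeff_b (turning_angle l) j * snd (l (j - 1))
     + (coeff_a (turning_angle l) j - coeff_a (turning_angle l) (j + 1)) * snd (l j)
     + coeff_b (turning_angle l) (j + 1) * snd (l (j + 1)))"
proof -
  obtain x y where P: "vertex l (j - 1) = (x, y)" by fastforce
  obtain x' y' where Q: "vertex l j = (x', y')" by fastforce
  \<comment> \<open>At the vertex stored at \<open>j - 1\<close>, \<open>l j\<close> is the second
    of the two lines. The shift in \<open>coeff_a\<close> and \<open>coeff_b\<close> gives its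
    coefficients the index \<open>j\<close>.\<close>
  have "- x * angle_sin (fst (l j)) + y * angle_cos (fst (l j)) =
      coeff_a (turning_angle l) j * snd (l j) - coeff_b (turning_angle l) j * snd (l (j - 1))"
    using line_intersection_direction_coordinates(2)[of x y "l (j - 1)" "l j"] P
      vertex_in_lines[OF assms, of "j - 1"] turning_angle_sin_nonzero[OF assms, of "j - 1"]
    by (simp add: coeff_a_def coeff_b_def turning_angle_def)
  \<comment> \<open>At the vertex stored at \<open>j\<close>, \<open>l j\<close> is the first line,
    and the coefficients have index \<open>j + 1\<close>.\<close>
  moreover have "- x' * angle_sin (fst (l j)) + y' * angle_cos (fst (l j)) =
      coeff_b (turning_angle l) (j + 1) * snd (l (j + 1)) - coeff_a (turning_angle l) (j + 1) * snd (l j)"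
    using line_intersection_direction_coordinates(1)[of x' y' "l j" "l (j + 1)"] Q
      vertex_in_lines[OF assms, of j] turning_angle_sin_nonzero[OF assms, of j]
    by (simp add: coeff_a_def coeff_b_def turning_angle_def)
  moreover have "snd (P_evolute l j) =
      ((- x * angle_sin (fst (l j)) + y * angle_cos (fst (l j))) +
       (- x' * angle_sin (fst (l j)) + y' * angle_cos (fst (l j)))) / 2"
    by (simp add: P_evolute_eq P Q midpoint_def field_simps)
  ultimately show ?thesis
    by (simp add: algebra_simps)
qed

lemma periodic_mod:
  fixes f :: "int \<Rightarrow> 'a"
  assumes "\<And>j. f (j + m) = f j"
  shows "f (j mod m) = f j"
proof -
  have add: "f (j + int k * m) = f j" for j k
  proof (induction k)
    case (Suc k)
    then show ?case
      using assms[of "j + int k * m"] by (simp add: algebra_simps)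
  qed simp
  have "f (j mod m + (j div m) * m) = f (j mod m)"
  proof (cases "j div m \<ge> 0")
    case True
    then show ?thesis
      using add[of "j mod m" "nat (j div m)"] by simp
  next
    \<comment> \<open>For a negative quotient, adding \<open>- (j div m)\<close> periods to
      \<open>j\<close> leads back to \<open>j mod m\<close>.\<close>
    case False
    then have "j mod m + (j div m) * m + int (nat (- (j div m))) * m = j mod m"
      by (simp add: algebra_simps)
    then show ?thesis
      using add[of "j mod m + (j div m) * m" "nat (- (j div m))"] by metis
  qed
  then show ?thesis
    by simp
qed

text \<open>Periodicity of \<open>l\<close> lets the wrapped index of the finite vector be read as
  the integer index \<open>j\<close>.\<close>

lemma cyc_entry_polygon:
  assumes "cooriented_polygon n l" "n > 0"
  shows "cyc_entry (vec n (\<lambda>j. snd (l (int j)))) j = snd (l j)"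
  using assms periodic_mod[of l "int n" j]
  by (simp add: cyc_entry_def cooriented_polygon_def nat_less_iff)

lemma cyc_entry_unit_vec:
  assumes "k < n"
  shows "cyc_entry (unit_vec n k) i = (if k = nat (i mod int n) then 1 else 0)"
  using assms by (simp add: cyc_entry_def unit_vec_def nat_less_iff)

lemma sum_cyc_entry_unit_vec:
  assumes "x \<in> carrier_vec n" "n > 0"
  shows "(\<Sum>k<n. cyc_entry (unit_vec n k) i * x $ k) = cyc_entry x i"
proof -
  have "(\<Sum>k<n. cyc_entry (unit_vec n k) i * x $ k) =
      (\<Sum>k<n. if k = nat (i mod int n) then x $ k else 0)"
    by (intro sum.cong) (auto simp: cyc_entry_unit_vec)
  also have "\<dots> = cyc_entry x i"
    using assms by (simp add: cyc_entry_def nat_less_iff)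
  finally show ?thesis .
qed

text \<open>\<open>P_action\<close> is linear in the vector, and the columns of the matrix are its
  values on the standard basis; each of its three terms is summed separately by
  \<open>sum_cyc_entry_unit_vec\<close>.\<close>

lemma P_matrix_mult_vec:
  assumes "x \<in> carrier_vec n" "j < n"
  shows "(P_matrix n \<theta> *\<^sub>v x) $ j = P_action \<theta> x (int j)"
proof -
  have n: "n > 0"
    using assms by simp
  have "(P_matrix n \<theta> *\<^sub>v x) $ j = (\<Sum>k<n. P_action \<theta> (unit_vec n k) (int j) * x $ k)"
    using assms by (simp add: P_matrix_def scalar_prod_def lessThan_atLeast0)
  also have "\<dots> = (\<Sum>k<n. 1/2 *
      (- coeff_b \<theta> j * (cyc_entry (unit_vec n k) (int j - 1) * x $ k)
       + (coeff_a \<theta> j - coeff_a \<theta> (int j + 1)) * (cyc_entry (unit_vec n k) (int j) * x $ k)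
       + coeff_b \<theta> (int j + 1) * (cyc_entry (unit_vec n k) (int j + 1) * x $ k)))"
    by (intro sum.cong) (auto simp: P_action_def algebra_simps)
  also have "\<dots> = P_action \<theta> x (int j)"
    unfolding sum_distrib_left[symmetric] sum.distrib sum_cyc_entry_unit_vec[OF assms(1) n]
    by (simp add: P_action_def)
  finally show ?thesis .
qed

text \<open>The entry at \<open>(j, k)\<close> combines the values of the \<open>k\<close>-th unit
  vector at the cyclic positions \<open>j - 1\<close>, \<open>j\<close>, \<open>j + 1\<close>, all
  zero unless \<open>k\<close> is one of them.\<close>

lemma cyclically_tridiagonal_P_matrix: "cyclically_tridiagonal n (P_matrix n \<theta>)"
  unfolding cyclically_tridiagonal_def
proof (intro conjI allI impI)
  show "P_matrix n \<theta> \<in> carrier_mat n n"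
    by (simp add: P_matrix_def)
  fix j k assume jk: "j < n" "k < n" and nz: "P_matrix n \<theta> $$ (j, k) \<noteq> 0"
  show "\<exists>d\<in>{-1, 0, 1}. int k = (int j + d) mod int n"
  proof (rule ccontr)
    assume "\<not> ?thesis"
    then have "cyc_entry (unit_vec n k) (int j + d) = 0" if "d \<in> {-1, 0, 1}" for d
      using jk that by (force simp: cyc_entry_unit_vec)
    from this[of "-1"] this[of 0] this[of 1] show False
      using nz jk by (simp add: P_matrix_def P_action_def)
  qed
qed

theorem theorem4:
  fixes n :: nat and l :: "int \<Rightarrow> coor_line" and \<theta> :: "int \<Rightarrow> angle"
  assumes "n \<ge> 3"
    and "cooriented_polygon n l"
    and "\<theta> = turning_angle l"
  shows "(\<forall>j. fst (P_evolute l j) = fst (l j) + angle_of (pi / 2)) \<and>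
    vec n (\<lambda>j. snd (P_evolute l (int j))) = P_matrix n \<theta> *\<^sub>v vec n (\<lambda>j. snd (l (int j))) \<and>
    cyclically_tridiagonal n (P_matrix n \<theta>) \<and>
    (\<forall>x \<in> carrier_vec n. \<forall>j<n. (P_matrix n \<theta> *\<^sub>v x) $ j = P_action \<theta> x (int j))"
proof (intro conjI allI ballI impI)
  have n: "n > 0"
    using assms(1) by simp
  show "vec n (\<lambda>j. snd (P_evolute l (int j))) = P_matrix n \<theta> *\<^sub>v vec n (\<lambda>j. snd (l (int j)))"
  proof (rule eq_vecI)
    fix j assume "j < dim_vec (P_matrix n \<theta> *\<^sub>v vec n (\<lambda>j. snd (l (int j))))"
    then have j: "j < n"
      by (simp add: P_matrix_def)
    \<comment> \<open>The right side is \<open>P_action\<close> on the offsets; with its cyclic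
      entries read as offsets of the lines it is the formula of
      \<open>snd_P_evolute\<close>.\<close>
    then show "vec n (\<lambda>j. snd (P_evolute l (int j))) $ j =
        (P_matrix n \<theta> *\<^sub>v vec n (\<lambda>j. snd (l (int j)))) $ j"
      by (simp add: P_matrix_mult_vec P_action_def cyc_entry_polygon[OF assms(2) n]
          snd_P_evolute[OF assms(2)] assms(3))
  qed (simp add: P_matrix_def)
qed (simp_all add: P_evolute_eq cyclically_tridiagonal_P_matrix P_matrix_mult_vec)

end
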